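(* Let $\mathcal{G}=(\mathcal{V},\mathcal{E})$ be a finite undirected graph without loops, with $\mathcal{V}=\mathcal{B}\cup\mathcal{I}$ partitioned into boundary nodes $\mathcal{B}$ and interior nodes $\mathcal{I}$. Let $\sigma\in(0,\infty)^{\mathcal{E}}$, $q',q''\in\mathbb{R}^{\mathcal{I}}$, $\omega_1\in\mathbb{R}\setminus\{0\}$, $\jmath=\sqrt{-1}$, $q(\omega_1)=q'+\jmath\omega_1q''$, and $N\ge1$. For $j=1,\ldots,N$ let $f_0^{(j)}\in\mathbb{R}^{\mathcal{B}}$, $f_1^{(j)}\in\mathbb{C}^{\mathcal{B}}$, and let $u_0^{(j)}\in\mathbb{R}^{\mathcal{V}}$, $u_1^{(j)}\in\mathbb{C}^{\mathcal{V}}$ satisfy $$(L_\sigma u_0^{(j)})_{\mathcal{I}}+q'\odot[u_0^{(j)}]_{\mathcal{I}}=0,\ [u_0^{(j)}]_{\mathcal{B}}=f_0^{(j)},\qquad (L_\sigma u_1^{(j)})_{\mathcal{I}}+q(\omega_1)\odot[u_1^{(j)}]_{\mathcal{I}}=0,\ [u_1^{(j)}]_{\mathcal{B}}=f_1^{(j)}.$$ Assume: (i) $\bigcup_{j=1}^N\operatorname{supp}[u_0^{(j)}]_{\mathcal{I}}=\mathcal{I}$, the matrix $[L_\sigma]_{\mathcal{I}\mathcal{I}}+\operatorname{diag}(q')$ is invertible, and for $j=1,\ldots,N$ the matrix $[L_\sigma]_{\mathcal{I}\mathcal{I}}+\operatorname{diag}(s^{(j)}\odot q')$ is invertible, where $s^{(j)}=1-2\,\mathbb{1}_{\operatorname{supp}[u_0^{(j)}]_{\mathcal{I}}}$;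 (ii) the Dirichlet problems for both $q'$ and $q'+\jmath\omega_1q''$ are well posed, i.e. $[L_\sigma]_{\mathcal{I}\mathcal{I}}+\operatorname{diag}(q')$ and $[L_\sigma]_{\mathcal{I}\mathcal{I}}+\operatorname{diag}(q'+\jmath\omega_1q'')$ are invertible; (iii) $q'$ does not vanish: $|q'(x)|>0$ for every $x\in\mathcal{I}$. Define for $j=1,\ldots,N$ the $|\mathcal{I}|\times|\mathcal{I}|$ complex matrices $$B^{(j)}=-\jmath\,\operatorname{diag}([\overline{u_1}^{(j)}]_{\mathcal{I}})\,[(L_\sigma)_{\mathcal{I}\mathcal{I}}+\operatorname{diag}(q(\omega_1))]^{-1}\,\operatorname{diag}([u_1^{(j)}]_{\mathcal{I}}).$$ If the $N|\mathcal{I}|\times|\mathcal{I}|$ real matrix $\operatorname{Re}([B^{(1)};\ldots;B^{(N)}])$ (vertical concatenation, entrywise real part) is full rank, i.e. has rank $|\mathcal{I}|$, then the linearization of the two-frequency complex inverse Schrödinger problem is injective. That is, if $\delta q',\delta q''\in\mathbb{R}^{\mathcal{I}}$, and $\delta u_0^{(j)}\in\mathbb{R}^{\mathcal{V}}$, $\delta u_1^{(j)}\in\mathbb{C}^{\mathcal{V}}$, $\delta\overline{u_1}^{(j)}\in\mathbb{C}^{\mathcal{V}}$ for $j=1,\ldots,N$ (with $\delta u_1^{(j)}$ and $\delta\overline{u_1}^{(j)}$ regarded as independent variables), satisfy for all $j=1,\ldots,N$ $$\delta q'\odot|[u_0^{(j)}]_{\mathcal{I}}|^2+2q'\odot[u_0^{(j)}]_{\mathcal{I}}\odot[\delta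 u_0^{(j)}]_{\mathcal{I}}=0,$$ $$\delta q'\odot|[u_1^{(j)}]_{\mathcal{I}}|^2+q'\odot[\overline{u_1}^{(j)}]_{\mathcal{I}}\odot[\delta u_1^{(j)}]_{\mathcal{I}}+q'\odot[u_1^{(j)}]_{\mathcal{I}}\odot[\delta\overline{u_1}^{(j)}]_{\mathcal{I}}=0,$$ $$(L_\sigma\delta u_0^{(j)})_{\mathcal{I}}+\delta q'\odot[u_0^{(j)}]_{\mathcal{I}}+q'\odot[\delta u_0^{(j)}]_{\mathcal{I}}=0,$$ $$(L_\sigma\delta u_1^{(j)})_{\mathcal{I}}+(\delta q'+\jmath\omega_1\delta q'')\odot[u_1^{(j)}]_{\mathcal{I}}+(q'+\jmath\omega_1q'')\odot[\delta u_1^{(j)}]_{\mathcal{I}}=0,$$ $$(L_\sigma\delta\overline{u_1}^{(j)})_{\mathcal{I}}+(\delta q'-\jmath\omega_1\delta q'')\odot[\overline{u_1}^{(j)}]_{\mathcal{I}}+(q'-\jmath\omega_1q'')\odot[\delta\overline{u_1}^{(j)}]_{\mathcal{I}}=0,$$ $$[\delta u_0^{(j)}]_{\mathcal{B}}=0,\quad[\delta u_1^{(j)}]_{\mathcal{B}}=0,\quad[\delta\overline{u_1}^{(j)}]_{\mathcal{B}}=0,$$ then $\delta q'=0$, $\delta q''=0$, and $\delta u_0^{(j)}=0$, $\delta u_1^{(j)}=0$, $\delta\overline{u_1}^{(j)}=0$ for all $j=1,\ldots,N$.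
   Context: For each edge $i\sim j$ an ordering of its endpoints is fixed once and for all. The discrete gradient $\nabla$ maps functions on $\mathcal{V}$ to functions on $\mathcal{E}$ by $(\nabla u)(i\sim j)=u(i)-u(j)$ (a real matrix), and $\nabla^T$ is its transpose. $\odot$ is the componentwise product; absolute values, squares and complex conjugates of vectors are componentwise, and $\overline{u_1}^{(j)}$ is the complex conjugate of $u_1^{(j)}$. $L_\sigma u=\nabla^T(\sigma\odot\nabla u)$ is the discrete Laplacian, viewed as a symmetric $|\mathcal{V}|\times|\mathcal{V}|$ matrix; $[L_\sigma]_{\mathcal{I}\mathcal{I}}=(L_\sigma)_{\mathcal{I}\mathcal{I}}$ is the submatrix with rows and columns in $\mathcal{I}$. A subscript $\mathcal{I}$ or $\mathcal{B}$ on a vector denotes restriction. $\operatorname{supp}g=\{x:g(x)\neq0\}$ and $\mathbb{1}_X$ is the indicator function of $X$. The two-frequency complex inverse Schrödinger problem is to find $(q',q'')$ and $(u_0^{(j)},u_1^{(j)},\overline{u_1}^{(j)})$, $j=1,\ldots,N$, from the data $q'\odot|[u_0^{(j)}]_{\mathcal{I}}|^2$ and $q'\odot|[u_1^{(j)}]_{\mathcal{I}}|^2$ at frequencies $0$ and $\omega_1$, together with the Schrödinger Dirichlet problems at these two frequencies (and the complex conjugate of the one at $\omega_1$) with known $\sigma$ and known boundary data; $u_1$ and $\overline{u_1}$ are treated as independent variables. The equations in the claim are its linearization with zero right-hand side. *)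

theory Defs
  imports
    Complex_Main
    "HOL-Library.Indicator_Function"
    "HOL-Library.Countable_Set"
    "Jordan_Normal_Form.Gauss_Jordan_Elimination"
    "Jordan_Normal_Form.DL_Rank"
begin

text \<open>An edge is the two-element set of its endpoints, which rules out loops and parallel edges.\<close>

definition fin_loopfree_graph :: "'v set \<Rightarrow> 'v set set \<Rightarrow> bool" where
  "fin_loopfree_graph V E \<longleftrightarrow> finite V \<and> (\<forall>e\<in>E. e \<subseteq> V \<and> card e = 2)"

definition orientation :: "'v set set \<Rightarrow> ('v set \<Rightarrow> 'v \<times> 'v) \<Rightarrow> bool" where
  "orientation E ori \<longleftrightarrow> (\<forall>e\<in>E. e = {fst (ori e), snd (ori e)})"

text \<open>Vectors indexed by the vertices (or by a subset of them) are total functions on \<open>'v\<close>;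
  only their values on the index set matter. The scalars are polymorphic, so that the same
  operators act on real and on complex vectors.\<close>

definition grad :: "('v set \<Rightarrow> 'v \<times> 'v) \<Rightarrow> ('v \<Rightarrow> 'k::real_field) \<Rightarrow> 'v set \<Rightarrow> 'k" where
  "grad ori u e = u (fst (ori e)) - u (snd (ori e))"

text \<open>The entry of the matrix of the gradient in row \<open>e\<close> and column \<open>x\<close> is the value at \<open>e\<close> of
  the gradient of the indicator function of \<open>{x}\<close>.\<close>

definition grad_transpose ::
    "'v set set \<Rightarrow> ('v set \<Rightarrow> 'v \<times> 'v) \<Rightarrow> ('v set \<Rightarrow> 'k::real_field) \<Rightarrow> 'v \<Rightarrow> 'k" where
  "grad_transpose E ori w x = (\<Sum>e\<in>E. grad ori (indicator {x}) e * w e)"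

definition laplacian ::
    "'v set set \<Rightarrow> ('v set \<Rightarrow> 'v \<times> 'v) \<Rightarrow> ('v set \<Rightarrow> real) \<Rightarrow> ('v \<Rightarrow> 'k::real_field) \<Rightarrow> 'v \<Rightarrow> 'k" where
  "laplacian E ori \<sigma> u = grad_transpose E ori (\<lambda>e. of_real (\<sigma> e) * grad ori u e)"

text \<open>Rows and columns indexed by a finite set \<open>X\<close> are numbered by the bijection
  \<open>from_nat_into X\<close> from \<open>{..<card X}\<close> onto \<open>X\<close>. The same numbering is used for every matrix over
  \<open>X\<close>. A different numbering permutes the rows and columns of all of them simultaneously, so
  sums, products, inverses, invertibility and rank do not depend on the choice.\<close>

definition laplacian_submat ::
    "'v set set \<Rightarrow> ('v set \<Rightarrow> 'v \<times> 'v) \<Rightarrow> ('v set \<Rightarrow> real) \<Rightarrow> 'v set \<Rightarrow> 'k::real_field mat" where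
  "laplacian_submat E ori \<sigma> X = Matrix.mat (card X) (card X)
     (\<lambda>(a, b). laplacian E ori \<sigma> (indicator {from_nat_into X b}) (from_nat_into X a))"

definition diag_on :: "'v set \<Rightarrow> ('v \<Rightarrow> 'k::zero) \<Rightarrow> 'k mat" where
  "diag_on X d = mat_diag (card X) (\<lambda>a. d (from_nat_into X a))"

text \<open>Meaningful only for invertible matrices, for which \<open>mat_inverse\<close> returns \<open>Some\<close>.\<close>

definition inv_mat :: "'k::field mat \<Rightarrow> 'k mat" where
  "inv_mat A = the (mat_inverse A)"

text \<open>Vertical concatenation of the \<open>n \<times> n\<close> matrices \<open>A 1, \<dots>, A N\<close>.\<close>

definition vstack :: "nat \<Rightarrow> nat \<Rightarrow> (nat \<Rightarrow> 'k mat) \<Rightarrow> 'k mat" where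
  "vstack N n A = Matrix.mat (N * n) n (\<lambda>(r, c). A (r div n + 1) $$ (r mod n, c))"

definition supp_on :: "'v set \<Rightarrow> ('v \<Rightarrow> 'k::zero) \<Rightarrow> 'v set" where
  "supp_on X g = {x \<in> X. g x \<noteq> 0}"

definition q_freq :: "('v \<Rightarrow> real) \<Rightarrow> ('v \<Rightarrow> real) \<Rightarrow> real \<Rightarrow> 'v \<Rightarrow> complex" where
  "q_freq q' q'' \<omega> x = complex_of_real (q' x) + \<i> * complex_of_real \<omega> * complex_of_real (q'' x)"

definition dirichlet_solution ::
    "'v set set \<Rightarrow> ('v set \<Rightarrow> 'v \<times> 'v) \<Rightarrow> ('v set \<Rightarrow> real) \<Rightarrow> 'v set \<Rightarrow> 'v set \<Rightarrow>
     ('v \<Rightarrow> 'k::real_field) \<Rightarrow> ('v \<Rightarrow> 'k) \<Rightarrow> ('v \<Rightarrow> 'k) \<Rightarrow> bool" where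
  "dirichlet_solution E ori \<sigma> B I q f u \<longleftrightarrow>
     (\<forall>x\<in>I. laplacian E ori \<sigma> u x + q x * u x = 0) \<and> (\<forall>x\<in>B. u x = f x)"

definition B_mat ::
    "'v set set \<Rightarrow> ('v set \<Rightarrow> 'v \<times> 'v) \<Rightarrow> ('v set \<Rightarrow> real) \<Rightarrow> 'v set \<Rightarrow>
     ('v \<Rightarrow> complex) \<Rightarrow> ('v \<Rightarrow> complex) \<Rightarrow> complex mat" where
  "B_mat E ori \<sigma> I q u =
     (- \<i>) \<cdot>\<^sub>m (diag_on I (\<lambda>x. cnj (u x)) *
       inv_mat (laplacian_submat E ori \<sigma> I + diag_on I q) *
       diag_on I u)"

end

theory Submission
  imports Defs
begin

text \<open>
  At frequency \<open>0\<close> the data equation says \<open>\<delta>q' u\<^sub>0 = - 2 q' \<delta>u\<^sub>0\<close> wherever \<open>u\<^sub>0 \<noteq> 0\<close>, while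
  \<open>\<delta>q' u\<^sub>0 = 0\<close> elsewhere. Substituting this into the linearized equation eliminates \<open>\<delta>q'\<close> and flips
  the sign of the potential on the support of \<open>u\<^sub>0\<close>: \<open>\<delta>u\<^sub>0\<close> solves the homogeneous Dirichlet problem
  for the potential \<open>s q'\<close>, which is well posed, so \<open>\<delta>u\<^sub>0 = 0\<close>. Then \<open>\<delta>q'\<close> vanishes on the support of
  each \<open>u\<^sub>0\<close>, and these supports cover the interior.

  With \<open>\<delta>q' = 0\<close>, the conjugate of \<open>\<delta>u1bar\<close> and \<open>\<delta>u\<^sub>1\<close> solve the same well-posed Dirichlet problem,
  so they agree although they were introduced as independent unknowns. As \<open>q'\<close> does not vanish, the
  data equation at frequency \<open>\<omega>\<^sub>1\<close> reduces to \<open>Re (cnj u\<^sub>1 \<cdot> \<delta>u\<^sub>1) = 0\<close>. Solving for \<open>\<delta>u\<^sub>1\<close> in terms of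
  \<open>\<delta>q''\<close> shows \<open>cnj u\<^sub>1 \<cdot> \<delta>u\<^sub>1 = \<omega>\<^sub>1 B \<delta>q''\<close>, where \<open>B\<close> is the matrix of the rank condition. So the real
  vector \<open>\<delta>q''\<close> lies in the kernel of the stacked matrix of real parts (the lemmas
  \<open>B_mat_mult_vec_on\<close> and \<open>Re_vstack_mult_eq_0\<close>), which is trivial because that matrix has full column
  rank. With \<open>\<delta>q'' = 0\<close>, well-posedness makes the remaining unknowns vanish.
\<close>

section \<open>Kernels of matrices of full rank\<close>

text \<open>The rank is the dimension of the span of the set of columns, so a repeated column would leave
  fewer than \<open>nc\<close> vectors to span.\<close>

lemma (in vec_space) full_rank_distinct_cols:
  assumes A: "A \<in> carrier_mat n nc" and rank: "rank A = nc"
  shows "distinct (cols A)"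
proof -
  obtain S where S: "maximal S (\<lambda>T. T \<subseteq> set (cols A) \<and> lin_indpt T)"
    using maximal_exists[of "(\<lambda>T. T \<subseteq> set (cols A) \<and> lin_indpt T)" "card (set (cols A))" "{}"]
    by (meson List.finite_set card_mono empty_iff empty_subsetI finite_lin_indpt2 rev_finite_subset)
  have "nc = card S"
    using rank_card_indpt[OF A S] rank by simp
  also have "\<dots> \<le> card (set (cols A))"
    using S by (simp add: card_mono maximal_def)
  finally have "length (cols A) \<le> card (set (cols A))"
    using A by simp
  then show ?thesis
    by (metis card_distinct card_length le_antisym)
qed

lemma (in vec_space) full_rank_imp_trivial_kernel:
  assumes A: "A \<in> carrier_mat n nc" and rank: "rank A = nc"
    and v: "v \<in> carrier_vec nc" and 0: "A *\<^sub>v v = 0\<^sub>v n"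
  shows "v = 0\<^sub>v nc"
  using full_rank_distinct_cols[OF A rank] full_rank_lin_indpt[OF A rank] lin_depI[OF A v _ 0]
  by blast

lemma inv_mat_left_inverse:
  assumes A: "A \<in> carrier_mat n n" and inv: "invertible_mat A"
  shows "inv_mat A \<in> carrier_mat n n" "inv_mat A * A = 1\<^sub>m n"
proof -
  obtain C where AC: "A * C = 1\<^sub>m n" and CA: "C * A = 1\<^sub>m (dim_row C)"
    using inv A unfolding invertible_mat_def inverts_mat_def by auto
  have C: "C \<in> carrier_mat n n"
    using A arg_cong[OF AC, of dim_col] arg_cong[OF CA, of dim_col] by auto
  then have "A \<in> Units (ring_mat TYPE('a) n ())"
    using A AC CA unfolding Units_def ring_mat_def by auto
  then obtain D where D: "mat_inverse A = Some D"
    using mat_inverse(1)[OF A, where b = "()"] by (cases "mat_inverse A") auto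
  show "inv_mat A \<in> carrier_mat n n" "inv_mat A * A = 1\<^sub>m n"
    using mat_inverse(2)[OF A D] unfolding inv_mat_def D by simp_all
qed

lemma smult_mat_mult_vec:
  fixes A :: "'a::comm_semiring_0 mat"
  assumes "A \<in> carrier_mat nr nc" and "v \<in> carrier_vec nc"
  shows "(k \<cdot>\<^sub>m A) *\<^sub>v v = k \<cdot>\<^sub>v (A *\<^sub>v v)"
  using assms by (intro eq_vecI) (auto simp: scalar_prod_def sum_distrib_left mult.assoc)

section \<open>The Schroedinger operator as a matrix\<close>

text \<open>The coordinate vector of a function, in the numbering of \<open>X\<close> that \<open>laplacian_submat\<close> and
  \<open>diag_on\<close> use.\<close>

definition vec_on :: "'v set \<Rightarrow> ('v \<Rightarrow> 'k) \<Rightarrow> 'k vec" where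
  "vec_on X u = vec (card X) (\<lambda>a. u (from_nat_into X a))"

lemma vec_on_carrier [simp]: "vec_on X u \<in> carrier_vec (card X)"
  and dim_vec_on [simp]: "dim_vec (vec_on X u) = card X"
  and vec_on_index [simp]: "a < card X \<Longrightarrow> vec_on X u $ a = u (from_nat_into X a)"
  by (simp_all add: vec_on_def)

lemma laplacian_submat_carrier [simp]: "laplacian_submat E ori \<sigma> X \<in> carrier_mat (card X) (card X)"
  by (simp add: laplacian_submat_def)

lemma diag_on_carrier [simp]: "diag_on X d \<in> carrier_mat (card X) (card X)"
  by (simp add: diag_on_def)

lemma sum_from_nat_into:
  assumes "finite X"
  shows "(\<Sum>a<card X. f (from_nat_into X a)) = sum f X"
  using sum.reindex_bij_betw[OF bij_betw_from_nat_into_finite[OF assms], of f] .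

lemma from_nat_into_in:
  assumes "a < card X"
  shows "from_nat_into X a \<in> X"
  using assms by (metis card.empty from_nat_into not_less_zero)

lemma vec_on_eq_iff:
  assumes "finite X"
  shows "vec_on X u = vec_on X v \<longleftrightarrow> (\<forall>x\<in>X. u x = v x)"
proof
  assume eq: "vec_on X u = vec_on X v"
  show "\<forall>x\<in>X. u x = v x"
  proof
    fix x assume "x \<in> X"
    then obtain a where "a < card X" "from_nat_into X a = x"
      using bij_betw_from_nat_into_finite[OF assms] unfolding bij_betw_def by (metis imageE lessThan_iff)
    then show "u x = v x"
      using arg_cong[OF eq, of "\<lambda>w. w $ a"] by simp
  qed
qed (auto intro!: eq_vecI simp: from_nat_into_in)

lemma vec_on_zero: "vec_on X (\<lambda>_. 0) = 0\<^sub>v (card X)"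
  by (intro eq_vecI) auto

lemma diag_on_mult_vec_on: "diag_on X d *\<^sub>v vec_on X u = vec_on X (\<lambda>x. d x * u x)"
proof (intro eq_vecI)
  fix a assume "a < dim_vec (vec_on X (\<lambda>x. d x * u x))"
  then have a: "a < card X" by simp
  then have "(diag_on X d *\<^sub>v vec_on X u) $ a =
      (\<Sum>b = 0..<card X. (if a = b then d (from_nat_into X b) else 0) * u (from_nat_into X b))"
    by (simp add: diag_on_def mat_diag_def scalar_prod_def)
  also have "\<dots> = (\<Sum>b = 0..<card X. if a = b then d (from_nat_into X b) * u (from_nat_into X b) else 0)"
    by (intro sum.cong) auto
  finally show "(diag_on X d *\<^sub>v vec_on X u) $ a = vec_on X (\<lambda>x. d x * u x) $ a"
    using a by simp
qed (simp add: diag_on_def mat_diag_def)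

lemma grad_eq_sum_indicator:
  fixes u :: "'v \<Rightarrow> 'k::real_field"
  assumes "finite X" and "\<forall>x\<in>e - X. u x = 0" and "e = {fst (ori e), snd (ori e)}"
  shows "grad ori u e = (\<Sum>y\<in>X. grad ori (indicator {y}) e * u y)"
proof -
  have val: "u x = (\<Sum>y\<in>X. indicator {y} x * u y)" if "x \<in> e" for x
  proof -
    have "(\<Sum>y\<in>X. indicator {y} x * u y) = (\<Sum>y\<in>X. if x = y then u y else 0)"
      by (intro sum.cong) (auto simp: indicator_def)
    then show ?thesis
      using assms(1,2) that by auto
  qed
  have "fst (ori e) \<in> e" "snd (ori e) \<in> e"
    using assms(3) by blast+
  then have "grad ori u e = (\<Sum>y\<in>X. indicator {y} (fst (ori e)) * u y) -
      (\<Sum>y\<in>X. indicator {y} (snd (ori e)) * u y)"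
    using val unfolding grad_def by metis
  then show ?thesis
    by (simp add: grad_def sum_subtractf left_diff_distrib)
qed

lemma laplacian_eq_sum_indicator:
  fixes u :: "'v \<Rightarrow> 'k::real_field"
  assumes "fin_loopfree_graph V E" and "orientation E ori"
    and "finite X" and "\<forall>x\<in>V - X. u x = 0"
  shows "laplacian E ori \<sigma> u x = (\<Sum>y\<in>X. laplacian E ori \<sigma> (indicator {y}) x * u y)"
proof -
  have g: "grad ori u e = (\<Sum>y\<in>X. grad ori (indicator {y}) e * u y)" if "e \<in> E" for e
    using assms that unfolding fin_loopfree_graph_def orientation_def
    by (intro grad_eq_sum_indicator) auto
  have "laplacian E ori \<sigma> u x =
      (\<Sum>e\<in>E. \<Sum>y\<in>X. grad ori (indicator {x}) e * (of_real (\<sigma> e) * grad ori (indicator {y}) e) * u y)"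
    unfolding laplacian_def grad_transpose_def
    by (intro sum.cong) (simp_all add: g sum_distrib_left mult.assoc)
  also have "\<dots> = (\<Sum>y\<in>X. laplacian E ori \<sigma> (indicator {y}) x * u y)"
    unfolding laplacian_def grad_transpose_def by (subst sum.swap) (simp add: sum_distrib_right)
  finally show ?thesis .
qed

text \<open>Extending by zero turns the principal submatrix on \<open>X\<close> into the operator itself: this is where
  homogeneous Dirichlet conditions on \<open>V - X\<close> enter.\<close>

lemma schroedinger_mult_vec_on:
  fixes u :: "'v \<Rightarrow> 'k::real_field"
  assumes "fin_loopfree_graph V E" and "orientation E ori"
    and "finite X" and "\<forall>x\<in>V - X. u x = 0"
  shows "(laplacian_submat E ori \<sigma> X + diag_on X d) *\<^sub>v vec_on X u =
    vec_on X (\<lambda>x. laplacian E ori \<sigma> u x + d x * u x)"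
proof -
  have "laplacian_submat E ori \<sigma> X *\<^sub>v vec_on X u = vec_on X (laplacian E ori \<sigma> u)"
  proof (intro eq_vecI)
    fix a assume "a < dim_vec (vec_on X (laplacian E ori \<sigma> u))"
    then have a: "a < card X" by simp
    let ?x = "from_nat_into X a"
    have "(laplacian_submat E ori \<sigma> X *\<^sub>v vec_on X u) $ a =
        (\<Sum>b<card X. laplacian E ori \<sigma> (indicator {from_nat_into X b}) ?x * u (from_nat_into X b))"
      using a by (auto simp: laplacian_submat_def scalar_prod_def lessThan_atLeast0 intro!: sum.cong)
    also have "\<dots> = (\<Sum>y\<in>X. laplacian E ori \<sigma> (indicator {y}) ?x * u y)"
      by (rule sum_from_nat_into[OF assms(3)])
    also have "\<dots> = laplacian E ori \<sigma> u ?x"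
      using laplacian_eq_sum_indicator[OF assms] by metis
    finally show "(laplacian_submat E ori \<sigma> X *\<^sub>v vec_on X u) $ a = vec_on X (laplacian E ori \<sigma> u) $ a"
      using a by simp
  qed (simp add: laplacian_submat_def)
  then have "(laplacian_submat E ori \<sigma> X + diag_on X d) *\<^sub>v vec_on X u =
      vec_on X (laplacian E ori \<sigma> u) + vec_on X (\<lambda>x. d x * u x)"
    by (subst add_mult_distrib_mat_vec[of _ "card X" "card X"]) (simp_all add: diag_on_mult_vec_on)
  then show ?thesis
    by (auto intro!: eq_vecI)
qed

text \<open>Well-posedness in the form of uniqueness. It serves to show that a perturbation of a state
  vanishes, and, applied to a difference, that two such perturbations agree.\<close>

lemma homogeneous_dirichlet_eq_0:
  fixes u :: "'v \<Rightarrow> 'k::real_field"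
  assumes "fin_loopfree_graph V E" and "orientation E ori"
    and X: "finite X" and "\<forall>x\<in>V - X. u x = 0"
    and inv: "invertible_mat (laplacian_submat E ori \<sigma> X + diag_on X d)"
    and eq: "\<forall>x\<in>X. laplacian E ori \<sigma> u x + d x * u x = 0"
  shows "\<forall>x\<in>X. u x = 0"
proof -
  let ?M = "laplacian_submat E ori \<sigma> X + diag_on X d" and ?n = "card X"
  have M: "?M \<in> carrier_mat ?n ?n" by simp
  have "?M *\<^sub>v vec_on X u = vec_on X (\<lambda>_. 0)"
    unfolding schroedinger_mult_vec_on[OF assms(1-4)] vec_on_eq_iff[OF X] using eq .
  then have "inv_mat ?M *\<^sub>v (?M *\<^sub>v vec_on X u) = inv_mat ?M *\<^sub>v 0\<^sub>v ?n"
    by (simp add: vec_on_zero)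
  moreover have "inv_mat ?M *\<^sub>v (?M *\<^sub>v vec_on X u) = vec_on X u"
    using inv_mat_left_inverse[OF M inv] assoc_mult_mat_vec[OF _ M vec_on_carrier]
    by (metis one_mult_mat_vec vec_on_carrier)
  moreover have "inv_mat ?M *\<^sub>v 0\<^sub>v ?n = 0\<^sub>v ?n"
    using inv_mat_left_inverse(1)[OF M inv] by (intro eq_vecI) auto
  ultimately have "vec_on X u = vec_on X (\<lambda>_. 0)"
    by (simp add: vec_on_zero)
  then show ?thesis
    unfolding vec_on_eq_iff[OF X] .
qed

lemma laplacian_diff:
  "laplacian E ori \<sigma> (\<lambda>y. u y - v y) x = laplacian E ori \<sigma> u x - laplacian E ori \<sigma> v x"
  unfolding laplacian_def grad_transpose_def sum_subtractf[symmetric]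
  by (intro sum.cong) (simp_all add: grad_def algebra_simps)

lemma cnj_laplacian: "cnj (laplacian E ori \<sigma> u x) = laplacian E ori \<sigma> (\<lambda>y. cnj (u y)) x"
proof -
  have "cnj (indicator A y) = indicator A y" for A :: "'a set" and y
    by (simp add: indicator_def)
  then show ?thesis
    by (simp add: laplacian_def grad_transpose_def grad_def)
qed

section \<open>The matrices of the rank condition\<close>

text \<open>The equation for \<open>v\<close> is the linearized one, with \<open>w\<close> in the role of \<open>\<delta>q''\<close>. Inverting the
  Schroedinger matrix expresses \<open>v\<close> through \<open>w\<close>; multiplying by \<open>cnj u\<close>, as the data do, gives \<open>B\<close> up
  to the factor \<open>\<omega>\<close>.\<close>

lemma B_mat_mult_vec_on:
  fixes u v w q :: "'v \<Rightarrow> complex" and \<omega> :: complex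
  assumes "fin_loopfree_graph V E" and "orientation E ori"
    and X: "finite X" and "\<forall>x\<in>V - X. v x = 0"
    and inv: "invertible_mat (laplacian_submat E ori \<sigma> X + diag_on X q)"
    and eq: "\<forall>x\<in>X. laplacian E ori \<sigma> v x + q x * v x = - \<i> * \<omega> * w x * u x"
  shows "\<omega> \<cdot>\<^sub>v (B_mat E ori \<sigma> X q u *\<^sub>v vec_on X w) = vec_on X (\<lambda>x. cnj (u x) * v x)"
proof -
  let ?M = "laplacian_submat E ori \<sigma> X + diag_on X q" and ?n = "card X"
  let ?D = "diag_on X u" and ?C = "diag_on X (\<lambda>x. cnj (u x))"
  have M: "?M \<in> carrier_mat ?n ?n" by simp
  note R = inv_mat_left_inverse[OF M inv]
  define z where "z = inv_mat ?M *\<^sub>v vec_on X (\<lambda>x. u x * w x)"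
  have z: "z \<in> carrier_vec ?n"
    using R(1) unfolding z_def by simp
  have "vec_on X v = inv_mat ?M *\<^sub>v (?M *\<^sub>v vec_on X v)"
    using R assoc_mult_mat_vec[OF _ M vec_on_carrier] by (metis one_mult_mat_vec vec_on_carrier)
  also have "?M *\<^sub>v vec_on X v = vec_on X (\<lambda>x. - \<i> * \<omega> * w x * u x)"
    unfolding schroedinger_mult_vec_on[OF assms(1-4)] vec_on_eq_iff[OF X] using eq .
  also have "\<dots> = (- \<i> * \<omega>) \<cdot>\<^sub>v vec_on X (\<lambda>x. u x * w x)"
    by (intro eq_vecI) simp_all
  also have "inv_mat ?M *\<^sub>v \<dots> = (- \<i> * \<omega>) \<cdot>\<^sub>v z"
    unfolding z_def by (rule mult_mat_vec[OF R(1) vec_on_carrier])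
  finally have v: "vec_on X v = (- \<i> * \<omega>) \<cdot>\<^sub>v z" .
  have "B_mat E ori \<sigma> X q u *\<^sub>v vec_on X w = (- \<i>) \<cdot>\<^sub>v (?C *\<^sub>v z)"
  proof -
    have CR: "?C * inv_mat ?M \<in> carrier_mat ?n ?n"
      using R(1) by (rule mult_carrier_mat[OF diag_on_carrier])
    have "(?C * inv_mat ?M * ?D) *\<^sub>v vec_on X w = ?C *\<^sub>v z"
      unfolding z_def diag_on_mult_vec_on[symmetric]
      using assoc_mult_mat_vec[OF CR diag_on_carrier vec_on_carrier]
        assoc_mult_mat_vec[OF diag_on_carrier R(1)] by (simp add: diag_on_mult_vec_on)
    moreover have "?C * inv_mat ?M * ?D \<in> carrier_mat ?n ?n"
      using CR diag_on_carrier by (rule mult_carrier_mat)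
    ultimately show ?thesis
      unfolding B_mat_def using smult_mat_mult_vec[OF _ vec_on_carrier] by metis
  qed
  then have "\<omega> \<cdot>\<^sub>v (B_mat E ori \<sigma> X q u *\<^sub>v vec_on X w) = ?C *\<^sub>v ((- \<i> * \<omega>) \<cdot>\<^sub>v z)"
    using mult_mat_vec[OF diag_on_carrier z] by (simp add: smult_smult_assoc mult.commute)
  then show ?thesis
    unfolding v[symmetric] diag_on_mult_vec_on .
qed

lemma B_mat_carrier:
  assumes "invertible_mat (laplacian_submat E ori \<sigma> X + diag_on X q)"
  shows "B_mat E ori \<sigma> X q u \<in> carrier_mat (card X) (card X)"
proof -
  have "inv_mat (laplacian_submat E ori \<sigma> X + diag_on X q) \<in> carrier_mat (card X) (card X)"
    using inv_mat_left_inverse(1)[OF _ assms] by simp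
  then show ?thesis
    unfolding B_mat_def by (intro smult_carrier_mat mult_carrier_mat[of _ _ "card X"]) auto
qed

text \<open>Because \<open>w\<close> is real, multiplying it by the real part of a complex matrix gives the real part of
  the product.\<close>

lemma Re_vstack_mult_eq_0:
  fixes w :: "real vec"
  assumes A: "\<And>j. j \<in> {1..N} \<Longrightarrow> A j \<in> carrier_mat n n"
    and w: "w \<in> carrier_vec n"
    and 0: "\<And>j a. j \<in> {1..N} \<Longrightarrow> a < n \<Longrightarrow> Re ((A j *\<^sub>v map_vec complex_of_real w) $ a) = 0"
  shows "map_mat Re (vstack N n A) *\<^sub>v w = 0\<^sub>v (N * n)"
proof (intro eq_vecI)
  fix r assume "r < dim_vec (0\<^sub>v (N * n))"
  then have r: "r < N * n" by simp
  define j a where "j = r div n + 1" and "a = r mod n"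
  have a: "a < n"
    using r unfolding a_def by (cases "n = 0") auto
  have j: "j \<in> {1..N}"
    using r unfolding j_def by (simp add: Suc_leI less_mult_imp_div_less)
  have "(map_mat Re (vstack N n A) *\<^sub>v w) $ r = (\<Sum>c = 0..<n. Re (A j $$ (a, c)) * w $ c)"
    using r w by (simp add: vstack_def scalar_prod_def j_def a_def)
  also have "\<dots> = Re ((A j *\<^sub>v map_vec complex_of_real w) $ a)"
    using a w A[OF j] by (simp add: scalar_prod_def)
  finally show "(map_mat Re (vstack N n A) *\<^sub>v w) $ r = 0\<^sub>v (N * n) $ r"
    using 0[OF j a] r by simp
qed (simp add: vstack_def)

section \<open>Injectivity of the linearized problem\<close>

text \<open>Where \<open>u\<close> vanishes the data equation carries no information, but there the term \<open>\<delta>q' u\<close> is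
  \<open>0\<close> as well; hence the same formula, with the sign flip supported on \<open>supp u\<close>, holds everywhere.\<close>

lemma potential_term_eq_sign_flip:
  fixes p :: "'v \<Rightarrow> real"
  assumes "x \<in> X" and "dp * \<bar>u x\<bar>\<^sup>2 + 2 * p x * u x * v = 0"
  shows "dp * u x + p x * v = (1 - 2 * indicator (supp_on X u) x) * p x * v"
proof (cases "u x = 0")
  case True
  then show ?thesis by (simp add: supp_on_def)
next
  case False
  have "u x * (dp * u x + 2 * p x * v) = 0"
    using assms(2) by (simp add: power2_eq_square algebra_simps)
  then have "dp * u x + 2 * (p x * v) = 0"
    using False by (simp add: mult.assoc)
  moreover have ind: "indicator (supp_on X u) x = (1::real)"
    using False assms(1) by (simp add: supp_on_def)
  moreover have "(1 - 2 * 1) * p x * v = - (p x * v)"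
    by simp
  ultimately show ?thesis
    unfolding ind by linarith
qed

theorem theorem5:
  fixes V B I :: "'v set" and E :: "'v set set" and ori :: "'v set \<Rightarrow> 'v \<times> 'v"
    and \<sigma> :: "'v set \<Rightarrow> real" and q' q'' :: "'v \<Rightarrow> real" and \<omega>\<^sub>1 :: real and N :: nat
    and f0 u0 :: "nat \<Rightarrow> 'v \<Rightarrow> real" and f1 u1 :: "nat \<Rightarrow> 'v \<Rightarrow> complex"
    and \<delta>q' \<delta>q'' :: "'v \<Rightarrow> real" and \<delta>u0 :: "nat \<Rightarrow> 'v \<Rightarrow> real"
    and \<delta>u1 \<delta>u1bar :: "nat \<Rightarrow> 'v \<Rightarrow> complex"
  assumes graph: "fin_loopfree_graph V E" and orient: "orientation E ori"
    and partition: "V = B \<union> I" "B \<inter> I = {}"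
    and sigma_pos: "\<forall>e\<in>E. \<sigma> e > 0"
    and omega: "\<omega>\<^sub>1 \<noteq> 0" and N: "N \<ge> 1"
    and sol0: "\<forall>j\<in>{1..N}. dirichlet_solution E ori \<sigma> B I q' (f0 j) (u0 j)"
    and sol1: "\<forall>j\<in>{1..N}. dirichlet_solution E ori \<sigma> B I (q_freq q' q'' \<omega>\<^sub>1) (f1 j) (u1 j)"
    and i_supp: "(\<Union>j\<in>{1..N}. supp_on I (u0 j)) = I"
    and i_inv: "invertible_mat (laplacian_submat E ori \<sigma> I + diag_on I q')"
    and i_inv_s: "\<forall>j\<in>{1..N}. invertible_mat (laplacian_submat E ori \<sigma> I +
          diag_on I (\<lambda>x. (1 - 2 * indicator (supp_on I (u0 j)) x) * q' x))"
    and ii_inv0: "invertible_mat (laplacian_submat E ori \<sigma> I + diag_on I q')"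
    and ii_inv1: "invertible_mat (laplacian_submat E ori \<sigma> I + diag_on I (q_freq q' q'' \<omega>\<^sub>1))"
    and iii: "\<forall>x\<in>I. \<bar>q' x\<bar> > 0"
    and full_rank: "vec_space.rank (N * card I)
          (map_mat Re (vstack N (card I)
             (\<lambda>j. B_mat E ori \<sigma> I (q_freq q' q'' \<omega>\<^sub>1) (u1 j)))) = card I"
    and lin_data0: "\<forall>j\<in>{1..N}. \<forall>x\<in>I.
          \<delta>q' x * \<bar>u0 j x\<bar>\<^sup>2 + 2 * q' x * u0 j x * \<delta>u0 j x = 0"
    and lin_data1: "\<forall>j\<in>{1..N}. \<forall>x\<in>I.
          complex_of_real (\<delta>q' x) * complex_of_real ((cmod (u1 j x))\<^sup>2)
          + complex_of_real (q' x) * cnj (u1 j x) * \<delta>u1 j x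
          + complex_of_real (q' x) * u1 j x * \<delta>u1bar j x = 0"
    and lin_eq0: "\<forall>j\<in>{1..N}. \<forall>x\<in>I.
          laplacian E ori \<sigma> (\<delta>u0 j) x + \<delta>q' x * u0 j x + q' x * \<delta>u0 j x = 0"
    and lin_eq1: "\<forall>j\<in>{1..N}. \<forall>x\<in>I.
          laplacian E ori \<sigma> (\<delta>u1 j) x
          + (complex_of_real (\<delta>q' x) + \<i> * complex_of_real \<omega>\<^sub>1 * complex_of_real (\<delta>q'' x)) * u1 j x
          + (complex_of_real (q' x) + \<i> * complex_of_real \<omega>\<^sub>1 * complex_of_real (q'' x)) * \<delta>u1 j x = 0"
    and lin_eq1bar: "\<forall>j\<in>{1..N}. \<forall>x\<in>I.
          laplacian E ori \<sigma> (\<delta>u1bar j) x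
          + (complex_of_real (\<delta>q' x) - \<i> * complex_of_real \<omega>\<^sub>1 * complex_of_real (\<delta>q'' x)) * cnj (u1 j x)
          + (complex_of_real (q' x) - \<i> * complex_of_real \<omega>\<^sub>1 * complex_of_real (q'' x)) * \<delta>u1bar j x = 0"
    and lin_bdry: "\<forall>j\<in>{1..N}. \<forall>x\<in>B. \<delta>u0 j x = 0 \<and> \<delta>u1 j x = 0 \<and> \<delta>u1bar j x = 0"
  shows "(\<forall>x\<in>I. \<delta>q' x = 0) \<and> (\<forall>x\<in>I. \<delta>q'' x = 0) \<and>
    (\<forall>j\<in>{1..N}. \<forall>x\<in>V. \<delta>u0 j x = 0 \<and> \<delta>u1 j x = 0 \<and> \<delta>u1bar j x = 0)"
proof -
  let ?q = "q_freq q' q'' \<omega>\<^sub>1" and ?n = "card I"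
  have I: "finite I"
    using graph partition(1) by (simp add: fin_loopfree_graph_def)
  have VI: "V - I = B"
    using partition by blast
  note dirichlet = homogeneous_dirichlet_eq_0[OF graph orient I, unfolded VI]

  \<comment> \<open>Eliminating \<open>\<delta>q'\<close> leaves a homogeneous problem for the sign-flipped potential.\<close>
  have \<delta>u0: "\<forall>x\<in>I. \<delta>u0 j x = 0" if j: "j \<in> {1..N}" for j
  proof (rule dirichlet)
    show "invertible_mat (laplacian_submat E ori \<sigma> I +
        diag_on I (\<lambda>x. (1 - 2 * indicator (supp_on I (u0 j)) x) * q' x))"
      using i_inv_s j by blast
    show "\<forall>x\<in>I. laplacian E ori \<sigma> (\<delta>u0 j) x
        + (1 - 2 * indicator (supp_on I (u0 j)) x) * q' x * \<delta>u0 j x = 0"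
    proof
      fix x assume x: "x \<in> I"
      have "\<delta>q' x * u0 j x + q' x * \<delta>u0 j x
          = (1 - 2 * indicator (supp_on I (u0 j)) x) * q' x * \<delta>u0 j x"
        using lin_data0 j x by (intro potential_term_eq_sign_flip) auto
      moreover have "laplacian E ori \<sigma> (\<delta>u0 j) x + \<delta>q' x * u0 j x + q' x * \<delta>u0 j x = 0"
        using lin_eq0 j x by blast
      ultimately show "laplacian E ori \<sigma> (\<delta>u0 j) x
          + (1 - 2 * indicator (supp_on I (u0 j)) x) * q' x * \<delta>u0 j x = 0"
        by linarith
    qed
  qed (use lin_bdry j in blast)
  have \<delta>q': "\<forall>x\<in>I. \<delta>q' x = 0"
  proof
    fix x assume x: "x \<in> I"
    then obtain j where j: "j \<in> {1..N}" and "u0 j x \<noteq> 0"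
      using i_supp unfolding supp_on_def by blast
    then show "\<delta>q' x = 0"
      using lin_data0 \<delta>u0 x by fastforce
  qed

  have eq1: "laplacian E ori \<sigma> (\<delta>u1 j) x + ?q x * \<delta>u1 j x
      = - \<i> * complex_of_real \<omega>\<^sub>1 * complex_of_real (\<delta>q'' x) * u1 j x"
    if j: "j \<in> {1..N}" and x: "x \<in> I" for j x
  proof -
    have "laplacian E ori \<sigma> (\<delta>u1 j) x
        + \<i> * complex_of_real \<omega>\<^sub>1 * complex_of_real (\<delta>q'' x) * u1 j x + ?q x * \<delta>u1 j x = 0"
      using lin_eq1 \<delta>q' j x by (auto simp: q_freq_def)
    then show ?thesis
      by (simp add: eq_neg_iff_add_eq_0 add_ac)
  qed
  have cnj_\<delta>u1bar: "\<forall>x\<in>I. \<delta>u1bar j x = cnj (\<delta>u1 j x)" if j: "j \<in> {1..N}" for j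
  proof -
    \<comment> \<open>Conjugating the equation for \<open>\<delta>u1bar\<close> gives that for \<open>\<delta>u1\<close>, with the same right-hand side.\<close>
    let ?d = "\<lambda>x. \<delta>u1 j x - cnj (\<delta>u1bar j x)"
    have "\<forall>x\<in>I. ?d x = 0"
    proof (rule dirichlet[OF _ ii_inv1])
      show "\<forall>x\<in>B. ?d x = 0"
        using lin_bdry j by simp
      show "\<forall>x\<in>I. laplacian E ori \<sigma> ?d x + ?q x * ?d x = 0"
      proof
        fix x assume x: "x \<in> I"
        have "cnj (laplacian E ori \<sigma> (\<delta>u1bar j) x
          + (complex_of_real (\<delta>q' x) - \<i> * complex_of_real \<omega>\<^sub>1 * complex_of_real (\<delta>q'' x)) * cnj (u1 j x)
          + (complex_of_real (q' x) - \<i> * complex_of_real \<omega>\<^sub>1 * complex_of_real (q'' x)) * \<delta>u1bar j x) = cnj 0"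
          using lin_eq1bar j x by metis
        then have "laplacian E ori \<sigma> (\<lambda>x. cnj (\<delta>u1bar j x)) x + ?q x * cnj (\<delta>u1bar j x)
            = - \<i> * complex_of_real \<omega>\<^sub>1 * complex_of_real (\<delta>q'' x) * u1 j x"
          using \<delta>q' x by (simp add: cnj_laplacian q_freq_def eq_neg_iff_add_eq_0 add_ac)
        moreover have "laplacian E ori \<sigma> ?d x + ?q x * ?d x
            = (laplacian E ori \<sigma> (\<delta>u1 j) x + ?q x * \<delta>u1 j x)
              - (laplacian E ori \<sigma> (\<lambda>x. cnj (\<delta>u1bar j x)) x + ?q x * cnj (\<delta>u1bar j x))"
          by (simp add: laplacian_diff algebra_simps)
        ultimately show "laplacian E ori \<sigma> ?d x + ?q x * ?d x = 0"
          using eq1[OF j x] by simp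
      qed
    qed
    then show ?thesis
      by (metis complex_cnj_cnj eq_iff_diff_eq_0)
  qed
  have Re_0: "Re (cnj (u1 j x) * \<delta>u1 j x) = 0" if j: "j \<in> {1..N}" and x: "x \<in> I" for j x
  proof -
    have "complex_of_real (q' x) * (cnj (u1 j x) * \<delta>u1 j x + cnj (cnj (u1 j x) * \<delta>u1 j x)) = 0"
      using lin_data1[rule_format, OF j x] \<delta>q' cnj_\<delta>u1bar[OF j] x by (simp add: algebra_simps)
    then have "cnj (u1 j x) * \<delta>u1 j x + cnj (cnj (u1 j x) * \<delta>u1 j x) = 0"
      using iii x by fastforce
    then show ?thesis
      by (simp only: complex_add_cnj of_real_eq_0_iff)
  qed

  let ?w = "vec_on I \<delta>q''"
  have "map_mat Re (vstack N ?n (\<lambda>j. B_mat E ori \<sigma> I ?q (u1 j))) *\<^sub>v ?w = 0\<^sub>v (N * ?n)"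
  proof (rule Re_vstack_mult_eq_0)
    fix j a assume j: "j \<in> {1..N}" and a: "a < ?n"
    let ?Bw = "B_mat E ori \<sigma> I ?q (u1 j) *\<^sub>v vec_on I (\<lambda>x. complex_of_real (\<delta>q'' x))"
    have "complex_of_real \<omega>\<^sub>1 \<cdot>\<^sub>v ?Bw = vec_on I (\<lambda>x. cnj (u1 j x) * \<delta>u1 j x)"
    proof (rule B_mat_mult_vec_on[OF graph orient I _ ii_inv1])
      show "\<forall>x\<in>V - I. \<delta>u1 j x = 0"
        using lin_bdry j VI by blast
      show "\<forall>x\<in>I. laplacian E ori \<sigma> (\<delta>u1 j) x + ?q x * \<delta>u1 j x
          = - \<i> * complex_of_real \<omega>\<^sub>1 * complex_of_real (\<delta>q'' x) * u1 j x"
        using eq1[OF j] by blast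
    qed
    from arg_cong[OF this, of "\<lambda>v. Re (v $ a)"] have "\<omega>\<^sub>1 * Re (?Bw $ a) = 0"
      using a Re_0[OF j from_nat_into_in[OF a]] B_mat_carrier[OF ii_inv1, of "u1 j"]
      by (simp del: index_mult_mat_vec)
    moreover have "map_vec complex_of_real ?w = vec_on I (\<lambda>x. complex_of_real (\<delta>q'' x))"
      by (intro eq_vecI) simp_all
    ultimately show "Re ((B_mat E ori \<sigma> I ?q (u1 j) *\<^sub>v map_vec complex_of_real ?w) $ a) = 0"
      using omega by simp
  qed (use B_mat_carrier[OF ii_inv1] in simp_all)
  then have "?w = vec_on I (\<lambda>_. 0)"
    unfolding vec_on_zero
    by (intro vec_space.full_rank_imp_trivial_kernel[OF _ full_rank]) (simp_all add: vstack_def)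
  then have \<delta>q'': "\<forall>x\<in>I. \<delta>q'' x = 0"
    unfolding vec_on_eq_iff[OF I] .

  have \<delta>u1: "\<forall>x\<in>I. \<delta>u1 j x = 0" if j: "j \<in> {1..N}" for j
  proof (rule dirichlet[OF _ ii_inv1])
    show "\<forall>x\<in>I. laplacian E ori \<sigma> (\<delta>u1 j) x + ?q x * \<delta>u1 j x = 0"
      using eq1[OF j] \<delta>q'' by simp
  qed (use lin_bdry j in blast)
  show ?thesis
    using \<delta>q' \<delta>q'' \<delta>u0 \<delta>u1 cnj_\<delta>u1bar lin_bdry partition(1) by auto
qed

end
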